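(* Let $m\neq0$ be a real number (the mass parameter). For $r$-forms $\overset{r}{\omega}\in K^r(4)$, $r=0,1,2,3,4$, set, for $r=1,2,3$, $$\overset{r}{\omega}_1=\overset{r}{\omega}+\frac1m\,\delta^c\overset{r+1}{\omega},\qquad \overset{r}{\omega}_2=-\frac1m\,\delta^c\overset{r+1}{\omega},$$ so that $\overset{r}{\omega}=\overset{r}{\omega}_1+\overset{r}{\omega}_2$, and let the forms $\overset{r\,r+1}{\Omega}$, $r=0,1,2,3$, be given by $$\overset{01}{\Omega}=\overset{0}{\omega}+\overset{1}{\omega}_1,\quad \overset{12}{\Omega}=\overset{1}{\omega}_2+\overset{2}{\omega}_1,\quad \overset{23}{\Omega}=\overset{2}{\omega}_2+\overset{3}{\omega}_1,\quad \overset{34}{\Omega}=\overset{3}{\omega}_2+\overset{4}{\omega}.$$ Then $\overset{r\,r+1}{\Omega}$ satisfies the discrete Duffin equation $$(d^c-\delta^c)\overset{r\,r+1}{\Omega}=m\overset{r\,r+1}{\Omega}$$ for $r=0,1,2,3$, and any solution $\Omega=\sum_{r=0}^4\overset{r}{\omega}$ of the discrete Dirac-Kähler equation $$(d^c-\delta^c)\Omega=m\Omega$$ can be uniquely represented as $$\Omega=\overset{01}{\Omega}+\overset{12}{\Omega}+\overset{23}{\Omega}+\overset{34}{\Omega}.$$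
   Context: Chains. Let $C=C^0\oplus C^1$, where $C^0$ is the real vector space with basis $x_\kappa$ ($\kappa\in\mathbb Z$) and $C^1$ the real vector space with basis $e_\kappa$ ($\kappa\in\mathbb Z$); put $\tau\kappa=\kappa+1$, $\partial x_\kappa=0$, $\partial e_\kappa=x_{\tau\kappa}-x_\kappa$. Let $C(4)=C\otimes C\otimes C\otimes C$, with basis elements $s_k=s_{k_0}\otimes s_{k_1}\otimes s_{k_2}\otimes s_{k_3}$, $k=(k_0,k_1,k_2,k_3)\in\mathbb Z^4$, each $s_{k_i}$ being $x_{k_i}$ or $e_{k_i}$; the dimension of $s_k$ is the number of factors of type $e$. The boundary is extended by $\partial(a\otimes b)=\partial a\otimes b+(-1)^{\dim a}a\otimes\partial b$ and linearity. Cochains (discrete forms). $K(4)=K\otimes K\otimes K\otimes K$ is the dual complex of real cochains, with basis elements $s^k=s^{k_0}\otimes s^{k_1}\otimes s^{k_2}\otimes s^{k_3}$, each $s^{k_i}$ being $x^{k_i}$ or $e^{k_i}$. Forms are (possibly infinite) formal real linear combinations of basis elements. The pairing is $\langle \varepsilon_k,s^k\rangle=1$ if $\varepsilon_k=s_k$ is the corresponding basis chain and $0$ otherwise, extended linearly. $K^r(4)$ is the space of forms of degree $r$, $K(4)=\bigoplus_{r=0}^4K^r(4)$. The coboundary $d^c:K^r(4)\to K^{r+1}(4)$ is defined by $\langle\partial a,\omega\rangle=\langle a,d^c\omega\rangle$ for all $(r+1)$-chains $a$; $d^c\omega=0$ for $\omega\in K^4(4)$. Cup product. On $K$: $x^\kappa\cup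 x^\kappa=x^\kappa$, $e^\kappa\cup x^{\tau\kappa}=e^\kappa$, $x^\kappa\cup e^\kappa=e^\kappa$, and all other products of basis elements are $0$. Inductively, for basis elements $s_{(p)},s_{(q)}$ of the $n$-fold tensor product of $K$ (of degrees $p,q$) and basis elements $s^\kappa,s^\mu$ of $K$, $(s_{(p)}\otimes s^\kappa)\cup(s_{(q)}\otimes s^\mu)=Q(\kappa,q)\,(s_{(p)}\cup s_{(q)})\otimes(s^\kappa\cup s^\mu)$, where $Q(\kappa,q)=-1$ if both $s^\kappa$ and $s_{(q)}$ have odd degree and $Q(\kappa,q)=+1$ otherwise. Extend linearly. Star operator (Lorentz signature). $\ast:K^r(4)\to K^{4-r}(4)$ is the linear bijection sending a basis element $s^k$ to the unique element of the form $\pm$(basis element) with $s^k\cup\ast s^k=Q(k_0)e^k$, where $e^k=e^{k_0}\otimes e^{k_1}\otimes e^{k_2}\otimes e^{k_3}$, $Q(k_0)=+1$ if $s^{k_0}=x^{k_0}$ and $Q(k_0)=-1$ if $s^{k_0}=e^{k_0}$ (so, up to sign, $\ast$ replaces each factor $x^{k_i}$ by $e^{k_i}$ and each factor $e^{k_i}$ by $x^{\tau k_i}$). Codifferential. $\delta^c:K^{r+1}(4)\to K^r(4)$, $\delta^c\psi=(-1)^{r+1}\ast^{-1}d^c\ast\psi$ for $\psi\in K^{r+1}(4)$, $r=0,1,2,3$; $\delta^c\omega=0$ for $\omega\in K^0(4)$. All operators act on inhomogeneous forms (sums of forms of different degrees) by linearity.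
   Formalization: The Duffin equations are claimed only when the r-forms are the components of a solution of the discrete Dirac-Kähler equation (false for arbitrary forms: take only the 0-form nonzero); uniqueness is among families of Duffin solutions lying in K^r + K^{r+1}. *)

theory Defs
  imports Complex_Main "HOL-Library.Poly_Mapping" "HOL-Library.Function_Algebras"
begin

(* Cells index both the basis of C (X k is x_k, E k is e_k) and the dual basis of K
   (X k is x^k, E k is e^k). The n-fold tensor powers are bracketed to the left, as in the
   inductive definition of the cup product. Chains are finite linear combinations of cells,
   forms are arbitrary, possibly infinite, formal ones, that is, coefficient functions. *)

datatype cell = X int | E int

type_synonym cell2 = "cell \<times> cell"
type_synonym cell3 = "cell2 \<times> cell"
type_synonym cell4 = "cell3 \<times> cell"

type_synonym 'a chain = "'a \<Rightarrow>\<^sub>0 real"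
type_synonym 'a form = "'a \<Rightarrow> real"

fun dim1 :: "cell \<Rightarrow> nat" where
  "dim1 (X k) = 0"
| "dim1 (E k) = 1"

definition dim_tensor :: "('a \<Rightarrow> nat) \<Rightarrow> 'a \<times> cell \<Rightarrow> nat" where
  "dim_tensor deg = (\<lambda>(a, s). deg a + dim1 s)"

definition dim2 :: "cell2 \<Rightarrow> nat" where "dim2 = dim_tensor dim1"
definition dim3 :: "cell3 \<Rightarrow> nat" where "dim3 = dim_tensor dim2"
definition dim4 :: "cell4 \<Rightarrow> nat" where "dim4 = dim_tensor dim3"


section \<open>Chains and the boundary\<close>

definition chain_scale :: "real \<Rightarrow> 'a chain \<Rightarrow> 'a chain" where
  "chain_scale c a = Poly_Mapping.map ((*) c) a"

definition chain_extend :: "('a \<Rightarrow> 'b chain) \<Rightarrow> 'a chain \<Rightarrow> 'b chain" where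
  "chain_extend f a = (\<Sum>s\<in>Poly_Mapping.keys a. chain_scale (Poly_Mapping.lookup a s) (f s))"

definition chain_tensor :: "'a chain \<Rightarrow> 'b chain \<Rightarrow> ('a \<times> 'b) chain" where
  "chain_tensor a b = (\<Sum>s\<in>Poly_Mapping.keys a. \<Sum>t\<in>Poly_Mapping.keys b.
     Poly_Mapping.single (s, t) (Poly_Mapping.lookup a s * Poly_Mapping.lookup b t))"

fun bd1 :: "cell \<Rightarrow> cell chain" where
  "bd1 (X k) = 0"
| "bd1 (E k) = Poly_Mapping.single (X (k + 1)) 1 - Poly_Mapping.single (X k) 1"

definition bd_tensor :: "('a \<Rightarrow> nat) \<Rightarrow> ('a \<Rightarrow> 'a chain) \<Rightarrow> 'a \<times> cell \<Rightarrow> ('a \<times> cell) chain" where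
  "bd_tensor deg bd = (\<lambda>(a, s).
     chain_tensor (bd a) (Poly_Mapping.single s 1)
     + chain_scale ((-1) ^ deg a) (chain_tensor (Poly_Mapping.single a 1) (bd1 s)))"

definition bd2 :: "cell2 \<Rightarrow> cell2 chain" where "bd2 = bd_tensor dim1 bd1"
definition bd3 :: "cell3 \<Rightarrow> cell3 chain" where "bd3 = bd_tensor dim2 bd2"
definition bd4 :: "cell4 \<Rightarrow> cell4 chain" where "bd4 = bd_tensor dim3 bd3"

definition boundary :: "cell4 chain \<Rightarrow> cell4 chain" where
  "boundary = chain_extend bd4"

definition Ch :: "nat \<Rightarrow> cell4 chain set" where
  "Ch r = {a. \<forall>s\<in>Poly_Mapping.keys a. dim4 s = r}"


section \<open>Forms and the coboundary\<close>

definition form_scale :: "real \<Rightarrow> 'a form \<Rightarrow> 'a form"  (infixr \<open>*\<^sub>F\<close> 75) where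
  "c *\<^sub>F \<omega> = (\<lambda>s. c * \<omega> s)"

definition basis_form :: "'a \<Rightarrow> 'a form" where
  "basis_form s = (\<lambda>t. if t = s then 1 else 0)"

definition K :: "nat \<Rightarrow> cell4 form set" where
  "K r = {\<omega>. \<forall>s. dim4 s \<noteq> r \<longrightarrow> \<omega> s = 0}"

definition form_part :: "nat \<Rightarrow> cell4 form \<Rightarrow> cell4 form" where
  "form_part r \<omega> = (\<lambda>s. if dim4 s = r then \<omega> s else 0)"

definition pairing :: "cell4 chain \<Rightarrow> cell4 form \<Rightarrow> real" where
  "pairing a \<omega> = (\<Sum>s\<in>Poly_Mapping.keys a. Poly_Mapping.lookup a s * \<omega> s)"

definition coboundary_deg :: "nat \<Rightarrow> cell4 form \<Rightarrow> cell4 form" where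
  "coboundary_deg r \<omega> =
     (if r < 4
      then THE \<eta>. \<eta> \<in> K (r + 1) \<and> (\<forall>a\<in>Ch (r + 1). pairing (boundary a) \<omega> = pairing a \<eta>)
      else 0)"

definition dc :: "cell4 form \<Rightarrow> cell4 form" where
  "dc \<omega> = (\<Sum>r\<le>4. coboundary_deg r (form_part r \<omega>))"


section \<open>Cup product\<close>

fun cup1 :: "cell \<Rightarrow> cell \<Rightarrow> cell form" where
  "cup1 (X k) (X l) = (if l = k then basis_form (X k) else 0)"
| "cup1 (E k) (X l) = (if l = k + 1 then basis_form (E k) else 0)"
| "cup1 (X k) (E l) = (if l = k then basis_form (E k) else 0)"
| "cup1 (E k) (E l) = 0"

definition form_tensor :: "'a form \<Rightarrow> 'b form \<Rightarrow> ('a \<times> 'b) form" where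
  "form_tensor \<phi> \<psi> = (\<lambda>(s, t). \<phi> s * \<psi> t)"

definition cup_tensor ::
  "('a \<Rightarrow> nat) \<Rightarrow> ('a \<Rightarrow> 'a \<Rightarrow> 'a form) \<Rightarrow> 'a \<times> cell \<Rightarrow> 'a \<times> cell \<Rightarrow> ('a \<times> cell) form" where
  "cup_tensor deg cup = (\<lambda>(a, s) (b, t).
     (if odd (dim1 s) \<and> odd (deg b) then -1 else 1) *\<^sub>F form_tensor (cup a b) (cup1 s t))"

definition cup2 :: "cell2 \<Rightarrow> cell2 \<Rightarrow> cell2 form" where "cup2 = cup_tensor dim1 cup1"
definition cup3 :: "cell3 \<Rightarrow> cell3 \<Rightarrow> cell3 form" where "cup3 = cup_tensor dim2 cup2"
definition cup4 :: "cell4 \<Rightarrow> cell4 \<Rightarrow> cell4 form" where "cup4 = cup_tensor dim3 cup3"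

(* Sum_any returns 0 on an infinite support. Here a given u occurs in the cup product s t (of
   basis elements) for only finitely many pairs (s, t), so the sum is always a finite one. *)
definition cup :: "cell4 form \<Rightarrow> cell4 form \<Rightarrow> cell4 form"  (infixl \<open>\<smile>\<close> 70) where
  "\<phi> \<smile> \<psi> = (\<lambda>u. Sum_any (\<lambda>(s, t). \<phi> s * \<psi> t * cup4 s t u))"


section \<open>Star operator and codifferential\<close>

fun vol1 :: "cell \<Rightarrow> cell" where
  "vol1 (X k) = E k"
| "vol1 (E k) = E k"

fun vol :: "cell4 \<Rightarrow> cell4" where
  "vol (((s0, s1), s2), s3) = (((vol1 s0, vol1 s1), vol1 s2), vol1 s3)"

(* The Lorentz sign, which depends on the factor with index 0 only. *)
fun lorentz_sign :: "cell4 \<Rightarrow> real" where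
  "lorentz_sign (((s0, s1), s2), s3) = (case s0 of X k \<Rightarrow> 1 | E k \<Rightarrow> -1)"

definition star_basis :: "cell4 \<Rightarrow> cell4 form" where
  "star_basis s = (THE \<phi>. (\<exists>t. \<phi> = basis_form t \<or> \<phi> = - basis_form t) \<and>
     basis_form s \<smile> \<phi> = lorentz_sign s *\<^sub>F basis_form (vol s))"

(* Linear extension to infinite formal combinations: for each u only one s contributes. *)
definition star :: "cell4 form \<Rightarrow> cell4 form" where
  "star \<omega> = (\<lambda>u. Sum_any (\<lambda>s. \<omega> s * star_basis s u))"

definition codiff_deg :: "nat \<Rightarrow> cell4 form \<Rightarrow> cell4 form" where
  "codiff_deg r \<psi> = (if r = 0 then 0 else (-1) ^ r *\<^sub>F inv star (dc (star \<psi>)))"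

definition codiff :: "cell4 form \<Rightarrow> cell4 form"  (\<open>\<delta>c\<close>) where
  "\<delta>c \<psi> = (\<Sum>r\<le>4. codiff_deg r (form_part r \<psi>))"


section \<open>The discrete Dirac-Kaehler and Duffin equations\<close>

(* The equation (dc - delta_c) Omega = m Omega. It is called the Dirac-Kaehler equation for an
   inhomogeneous form Omega in K(4), and the Duffin equation for Omega in K^r + K^(r+1). *)
definition DK_equation :: "real \<Rightarrow> cell4 form \<Rightarrow> bool" where
  "DK_equation m \<Omega> \<longleftrightarrow> dc \<Omega> - \<delta>c \<Omega> = m *\<^sub>F \<Omega>"

definition K_pair :: "nat \<Rightarrow> cell4 form set" where
  "K_pair r = {\<alpha> + \<beta> | \<alpha> \<beta>. \<alpha> \<in> K r \<and> \<beta> \<in> K (r + 1)}"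

definition Duffin_equation :: "real \<Rightarrow> nat \<Rightarrow> cell4 form \<Rightarrow> bool" where
  "Duffin_equation m r \<Omega> \<longleftrightarrow> \<Omega> \<in> K_pair r \<and> dc \<Omega> - \<delta>c \<Omega> = m *\<^sub>F \<Omega>"

definition part1 :: "real \<Rightarrow> (nat \<Rightarrow> cell4 form) \<Rightarrow> nat \<Rightarrow> cell4 form" where
  "part1 m \<omega> r = \<omega> r + (1 / m) *\<^sub>F \<delta>c (\<omega> (r + 1))"

definition part2 :: "real \<Rightarrow> (nat \<Rightarrow> cell4 form) \<Rightarrow> nat \<Rightarrow> cell4 form" where
  "part2 m \<omega> r = - ((1 / m) *\<^sub>F \<delta>c (\<omega> (r + 1)))"

(* The splitting is used in degrees 1, 2, 3 only; degrees 0 and 4 are not split. *)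
definition Duffin_form :: "real \<Rightarrow> (nat \<Rightarrow> cell4 form) \<Rightarrow> nat \<Rightarrow> cell4 form" where
  "Duffin_form m \<omega> r =
     (if r = 0 then \<omega> 0 else part2 m \<omega> r) + (if r = 3 then \<omega> 4 else part1 m \<omega> (r + 1))"

end

theory Submission
  imports Defs
begin

text \<open>
  The coboundary is the transpose of the boundary, \<open>(dc \<omega>)(s) = \<omega>(\<partial>s)\<close>, so \<open>dc\<close> raises the degree
  by one and squares to zero. The star operator permutes the basis up to signs, hence is
  invertible, and \<open>\<delta>c = star\<inverse> \<circ> dc \<circ> star \<circ> \<sigma>\<close> with \<open>\<sigma> = (-1)\<^sup>r\<close> in degree \<open>r\<close>; as \<open>\<sigma>\<close> commutes with
  \<open>star\<close> and anticommutes with \<open>dc\<close>, also \<open>\<delta>c\<close> squares to zero.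

  In degree \<open>r + 1\<close> the Dirac-Kaehler equation reads \<open>dc \<omega>\<^sub>r - \<delta>c \<omega>\<^sub>r\<^sub>+\<^sub>2 = m \<omega>\<^sub>r\<^sub>+\<^sub>1\<close>. It turns the
  \<open>r\<close>-th summand into \<open>(dc \<omega>\<^sub>r - \<delta>c \<omega>\<^sub>r\<^sub>+\<^sub>1) / m\<close>, and applying \<open>dc\<close> or \<open>\<delta>c\<close> to the
  Dirac-Kaehler equation gives
  \<open>dc \<delta>c \<omega>\<^sub>r\<^sub>+\<^sub>1 = - m dc \<omega>\<^sub>r\<close> and \<open>\<delta>c dc \<omega>\<^sub>r = m \<delta>c \<omega>\<^sub>r\<^sub>+\<^sub>1\<close>, which is the Duffin equation for this
  summand. Conversely, if \<open>\<alpha> + \<beta>\<close> with \<open>\<alpha>\<close> in degree \<open>r\<close> and \<open>\<beta>\<close> in degree \<open>r + 1\<close> solves the Duffin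
  equation, then \<open>\<delta>c \<alpha> = 0\<close>, \<open>dc \<beta> = 0\<close>, \<open>dc \<alpha> = m \<beta>\<close> and \<open>- \<delta>c \<beta> = m \<alpha>\<close>. In a sum of such solutions
  only \<open>\<alpha>\<close> contributes to \<open>dc \<omega>\<^sub>r\<close> and only \<open>\<beta>\<close> to \<open>\<delta>c \<omega>\<^sub>r\<^sub>+\<^sub>1\<close>, so the sum determines both.
\<close>


section \<open>Evaluation of forms on chains\<close>

text \<open>\<open>pairing\<close> exists only for \<open>cell4\<close>; the boundary is built one
  tensor factor at a time, so evaluation is needed over every cell type.\<close>

definition eval_chain :: "'a chain \<Rightarrow> 'a form \<Rightarrow> real" where
  "eval_chain a \<omega> = (\<Sum>s\<in>Poly_Mapping.keys a. Poly_Mapping.lookup a s * \<omega> s)"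

lemma pairing_eq_eval_chain: "pairing a \<omega> = eval_chain a \<omega>"
  by (simp add: pairing_def eval_chain_def)

lemma eval_chain_superset:
  assumes "finite S" "Poly_Mapping.keys a \<subseteq> S"
  shows "eval_chain a \<omega> = (\<Sum>s\<in>S. Poly_Mapping.lookup a s * \<omega> s)"
  unfolding eval_chain_def using assms
  by (intro sum.mono_neutral_left) (auto simp: in_keys_iff)

lemma eval_chain_zero [simp]: "eval_chain 0 \<omega> = 0"
  by (simp add: eval_chain_def)

lemma eval_chain_single [simp]: "eval_chain (Poly_Mapping.single s c) \<omega> = c * \<omega> s"
  by (subst eval_chain_superset[of "{s}"]) (auto simp: in_keys_iff lookup_single when_def)

lemma eval_chain_add [simp]: "eval_chain (a + b) \<omega> = eval_chain a \<omega> + eval_chain b \<omega>"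
  by (subst (1 2 3) eval_chain_superset[of "Poly_Mapping.keys a \<union> Poly_Mapping.keys b"])
    (auto simp: Poly_Mapping.keys_add lookup_add distrib_right sum.distrib)

lemma eval_chain_diff [simp]: "eval_chain (a - b) \<omega> = eval_chain a \<omega> - eval_chain b \<omega>"
  using eval_chain_add[of "a - b" b \<omega>] by simp

lemma eval_chain_sum: "eval_chain (\<Sum>i\<in>I. f i) \<omega> = (\<Sum>i\<in>I. eval_chain (f i) \<omega>)"
  by (induction I rule: infinite_finite_induct) auto

lemma eval_chain_scale [simp]: "eval_chain (chain_scale c a) \<omega> = c * eval_chain a \<omega>"
  by (subst (1 2) eval_chain_superset[of "Poly_Mapping.keys a"])
    (auto simp: chain_scale_def in_keys_iff Poly_Mapping.map.rep_eq when_def sum_distrib_left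
      mult.assoc intro!: sum.cong)

lemma eval_chain_extend [simp]:
  "eval_chain (chain_extend f a) \<omega> = eval_chain a (\<lambda>s. eval_chain (f s) \<omega>)"
  by (simp add: chain_extend_def eval_chain_sum) (simp add: eval_chain_def)

text \<open>A Fubini rule: evaluating factor by factor removes \<open>chain_tensor\<close> from all
  later arguments.\<close>

lemma eval_chain_tensor [simp]:
  "eval_chain (chain_tensor a b) \<omega> = eval_chain a (\<lambda>s. eval_chain b (\<lambda>t. \<omega> (s, t)))"
  by (simp add: chain_tensor_def eval_chain_sum)
    (simp add: eval_chain_def sum_distrib_left mult.assoc)

lemma eval_chain_cong:
  assumes "\<And>s. s \<in> Poly_Mapping.keys a \<Longrightarrow> \<omega> s = \<eta> s"
  shows "eval_chain a \<omega> = eval_chain a \<eta>"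
  using assms by (simp add: eval_chain_def)

lemma eval_chain_form_add: "eval_chain a (\<lambda>s. \<omega> s + \<eta> s) = eval_chain a \<omega> + eval_chain a \<eta>"
  by (simp add: eval_chain_def distrib_left sum.distrib)

lemma eval_chain_form_diff: "eval_chain a (\<lambda>s. \<omega> s - \<eta> s) = eval_chain a \<omega> - eval_chain a \<eta>"
  by (simp add: eval_chain_def right_diff_distrib sum_subtractf)

lemma eval_chain_form_scale: "eval_chain a (\<lambda>s. c * \<omega> s) = c * eval_chain a \<omega>"
  by (simp add: eval_chain_def sum_distrib_left mult.left_commute)

lemma eval_chain_form_zero [simp]: "eval_chain a (\<lambda>s. 0) = 0"
  by (simp add: eval_chain_def)


section \<open>The coboundary\<close>

definition boundary_degree :: "('a \<Rightarrow> nat) \<Rightarrow> ('a \<Rightarrow> 'a chain) \<Rightarrow> bool" where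
  "boundary_degree deg bd \<longleftrightarrow> (\<forall>s. \<forall>t\<in>Poly_Mapping.keys (bd s). deg s = Suc (deg t))"

text \<open>The relation \<partial>\<partial> = 0, tested against all forms; read as a statement
  about \<open>\<omega>\<close>, it says that the transpose squares to zero.\<close>

definition boundary_square_zero :: "('a \<Rightarrow> 'a chain) \<Rightarrow> bool" where
  "boundary_square_zero bd \<longleftrightarrow> (\<forall>s \<omega>. eval_chain (bd s) (\<lambda>t. eval_chain (bd t) \<omega>) = 0)"

lemma keys_chain_scale: "Poly_Mapping.keys (chain_scale c a) \<subseteq> Poly_Mapping.keys a"
  by (auto simp: chain_scale_def in_keys_iff Poly_Mapping.map.rep_eq when_def)

lemma keys_chain_tensor:
  "Poly_Mapping.keys (chain_tensor a b) \<subseteq> Poly_Mapping.keys a \<times> Poly_Mapping.keys b"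
  unfolding chain_tensor_def
  by (intro order.trans[OF Poly_Mapping.keys_sum] UN_least) (auto split: if_splits)

lemma boundary_degreeD:
  "boundary_degree deg bd \<Longrightarrow> t \<in> Poly_Mapping.keys (bd s) \<Longrightarrow> deg s = Suc (deg t)"
  by (simp add: boundary_degree_def)

lemma boundary_degree_bd1: "boundary_degree dim1 bd1"
  unfolding boundary_degree_def
proof (intro allI ballI)
  fix s t assume "t \<in> Poly_Mapping.keys (bd1 s)"
  then show "dim1 s = Suc (dim1 t)"
    by (cases s) (auto dest!: subsetD[OF keys_diff])
qed

lemma boundary_square_zero_bd1: "boundary_square_zero bd1"
  unfolding boundary_square_zero_def
proof (intro allI)
  fix s \<omega> show "eval_chain (bd1 s) (\<lambda>t. eval_chain (bd1 t) \<omega>) = 0"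
    by (cases s) auto
qed

text \<open>By the Leibniz rule a cell in the boundary of \<open>(a, x)\<close> differs from it in
  exactly one factor, and there the dimension drops by one.\<close>

lemma boundary_degree_tensor:
  assumes "boundary_degree deg bd"
  shows "boundary_degree (dim_tensor deg) (bd_tensor deg bd)"
  unfolding boundary_degree_def
proof (intro allI ballI)
  fix s t assume t: "t \<in> Poly_Mapping.keys (bd_tensor deg bd s)"
  obtain a x where s: "s = (a, x)" by (cases s)
  have "t \<in> Poly_Mapping.keys (bd a) \<times> {x} \<union> {a} \<times> Poly_Mapping.keys (bd1 x)"
    using t unfolding s bd_tensor_def
    by (auto dest!: subsetD[OF Poly_Mapping.keys_add] subsetD[OF keys_chain_scale]
        subsetD[OF keys_chain_tensor])
  then show "dim_tensor deg s = Suc (dim_tensor deg t)"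
    using assms boundary_degree_bd1 by (auto simp: s dim_tensor_def boundary_degree_def)
qed

lemma eval_bd_tensor:
  "eval_chain (bd_tensor deg bd (a, s)) \<omega> =
    eval_chain (bd a) (\<lambda>b. \<omega> (b, s)) + (-1) ^ deg a * eval_chain (bd1 s) (\<lambda>t. \<omega> (a, t))"
  by (simp add: bd_tensor_def)

text \<open>The operators \<open>D\<close> and \<open>D1\<close> of the two factors commute and each
  squares to zero. The mixed terms carry the signs of \<open>b\<close> and of \<open>a\<close>;
  these are opposite, as \<open>b\<close> has degree one less, so the terms cancel.\<close>

lemma boundary_square_zero_tensor:
  assumes deg: "boundary_degree deg bd" and sq: "boundary_square_zero bd"
  shows "boundary_square_zero (bd_tensor deg bd)"
  unfolding boundary_square_zero_def
proof (intro allI)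
  fix s :: "'a \<times> cell" and \<omega>
  obtain a x where s: "s = (a, x)" by (cases s)
  define D where "D = (\<lambda>\<eta> b. eval_chain (bd b) \<eta>)"
  define D1 where "D1 = (\<lambda>\<eta> y. eval_chain (bd1 y) \<eta>)"
  have DD: "D (D \<eta>) b = 0" for \<eta> b
    using sq by (simp add: D_def boundary_square_zero_def)
  have D1D1: "D1 (D1 \<eta>) y = 0" for \<eta> y
    using boundary_square_zero_bd1 by (simp add: D1_def boundary_square_zero_def)
  \<comment> \<open>\<open>bd1 x\<close> is zero or a difference of two cells, so interchanging the
    two evaluations is linearity in the form.\<close>
  have comm: "D1 (\<lambda>y. D (\<lambda>b. \<omega> (b, y)) a) x = D (\<lambda>b. D1 (\<lambda>y. \<omega> (b, y)) x) a"
    by (cases x) (simp_all add: D_def D1_def eval_chain_form_diff)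
  have sign: "D (\<lambda>b. (-1) ^ deg b * \<eta> b) a = - ((-1) ^ deg a) * D \<eta> a" for \<eta>
  proof -
    have "D (\<lambda>b. (-1) ^ deg b * \<eta> b) a = D (\<lambda>b. - ((-1) ^ deg a) * \<eta> b) a"
      unfolding D_def using deg by (intro eval_chain_cong) (auto dest: boundary_degreeD)
    then show ?thesis by (simp add: D_def eval_chain_form_scale del: mult_minus_left)
  qed
  have add: "D (\<lambda>b. f b + g b) a = D f a + D g a" for f g
    by (simp add: D_def eval_chain_form_add)
  have add1: "D1 (\<lambda>y. f y + c * g y) x = D1 f x + c * D1 g x" for f g c
    by (simp add: D1_def eval_chain_form_add eval_chain_form_scale)
  have "eval_chain (bd_tensor deg bd s) (\<lambda>t. eval_chain (bd_tensor deg bd t) \<omega>) =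
    D (\<lambda>b. D (\<lambda>c. \<omega> (c, x)) b + (-1) ^ deg b * D1 (\<lambda>y. \<omega> (b, y)) x) a
    + (-1) ^ deg a * D1 (\<lambda>y. D (\<lambda>b. \<omega> (b, y)) a + (-1) ^ deg a * D1 (\<lambda>z. \<omega> (a, z)) y) x"
    by (simp add: s eval_bd_tensor D_def D1_def)
  also have "\<dots> = 0"
    by (simp only: add add1 sign comm) (simp add: DD D1D1)
  finally show "eval_chain (bd_tensor deg bd s) (\<lambda>t. eval_chain (bd_tensor deg bd t) \<omega>) = 0" .
qed

lemma boundary_degree_bd4: "boundary_degree dim4 bd4"
  unfolding dim4_def bd4_def dim3_def bd3_def dim2_def bd2_def
  by (intro boundary_degree_tensor boundary_degree_bd1)

lemma boundary_square_zero_bd4: "boundary_square_zero bd4"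
  unfolding bd4_def dim3_def bd3_def dim2_def bd2_def
  by (intro boundary_square_zero_tensor boundary_degree_tensor boundary_degree_bd1
      boundary_square_zero_bd1)

section \<open>The coboundary as the transpose of the boundary\<close>

lemma dim1_le: "dim1 s \<le> 1"
  by (cases s) auto

lemma dim4_le: "dim4 s \<le> 4"
proof -
  obtain a b c d where s: "s = (((a, b), c), d)" by (metis prod.exhaust)
  show ?thesis
    using dim1_le[of a] dim1_le[of b] dim1_le[of c] dim1_le[of d]
    by (simp add: s dim4_def dim3_def dim2_def dim_tensor_def)
qed

text \<open>Chains consisting of a single cell determine \<open>\<eta>\<close> in dimension
  \<open>r + 1\<close>, and membership in \<open>K (r + 1)\<close> makes it zero elsewhere, which
  pins down the definite description.\<close>

lemma coboundary_deg_eq: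
  assumes "r < 4"
  shows "coboundary_deg r \<omega> = (\<lambda>s. if dim4 s = r + 1 then eval_chain (bd4 s) \<omega> else 0)"
    (is "_ = ?\<eta>")
proof -
  have "(THE \<eta>. \<eta> \<in> K (r + 1) \<and> (\<forall>a\<in>Ch (r + 1). pairing (boundary a) \<omega> = pairing a \<eta>)) = ?\<eta>"
  proof (rule the_equality, intro conjI ballI)
    fix a assume "a \<in> Ch (r + 1)"
    then show "pairing (boundary a) \<omega> = pairing a ?\<eta>"
      by (auto simp: pairing_eq_eval_chain boundary_def Ch_def intro!: eval_chain_cong)
  next
    fix \<eta>
    assume \<eta>: "\<eta> \<in> K (r + 1) \<and> (\<forall>a\<in>Ch (r + 1). pairing (boundary a) \<omega> = pairing a \<eta>)"
    show "\<eta> = ?\<eta>"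
    proof
      fix s
      show "\<eta> s = ?\<eta> s"
      proof (cases "dim4 s = r + 1")
        case True
        then have "Poly_Mapping.single s 1 \<in> Ch (r + 1)" by (auto simp: Ch_def)
        then have "pairing (boundary (Poly_Mapping.single s 1)) \<omega> =
            pairing (Poly_Mapping.single s 1) \<eta>"
          using \<eta> by blast
        with True show ?thesis by (simp add: pairing_eq_eval_chain boundary_def)
      next
        case False
        with \<eta> have "\<eta> s = 0" unfolding K_def by blast
        with False show ?thesis by simp
      qed
    qed
  qed (simp add: K_def)
  with assms show ?thesis by (simp add: coboundary_deg_def)
qed

lemma sum_form_apply: "(\<Sum>i\<in>I. f i) s = (\<Sum>i\<in>I. (f i s :: real))"
  by (induction I rule: infinite_finite_induct) auto

text \<open>At \<open>s\<close> only the summand with \<open>r + 1 = dim4 s\<close> survives, and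
  restricting to degree \<open>r\<close> is harmless because all cells of \<open>bd4 s\<close> have
  that dimension.\<close>

lemma dc_eq: "dc \<omega> = (\<lambda>s. eval_chain (bd4 s) \<omega>)"
proof
  fix s
  have "dc \<omega> s = (\<Sum>r\<le>4. coboundary_deg r (form_part r \<omega>) s)"
    by (simp add: dc_def sum_form_apply)
  also have "\<dots> = (\<Sum>r\<le>4. if Suc r = dim4 s then eval_chain (bd4 s) \<omega> else 0)"
  proof (rule sum.cong)
    fix r :: nat assume "r \<in> {..4}"
    show "coboundary_deg r (form_part r \<omega>) s = (if Suc r = dim4 s then eval_chain (bd4 s) \<omega> else 0)"
    proof (cases "r < 4")
      case True
      have "eval_chain (bd4 s) (form_part r \<omega>) = eval_chain (bd4 s) \<omega>" if "dim4 s = Suc r"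
        using that boundary_degree_bd4
        by (intro eval_chain_cong) (auto simp: form_part_def dest: boundary_degreeD)
      with True show ?thesis by (auto simp: coboundary_deg_eq)
    next
      case False
      then show ?thesis using dim4_le[of s] by (simp add: coboundary_deg_def)
    qed
  qed simp
  also have "\<dots> = eval_chain (bd4 s) \<omega>"
  proof (cases "dim4 s")
    \<comment> \<open>No summand has \<open>Suc r = 0\<close>, and the boundary of a 0-cell is
      empty, so both sides are zero.\<close>
    case 0
    then have "t \<notin> Poly_Mapping.keys (bd4 s)" for t
      using boundary_degreeD[OF boundary_degree_bd4, of t s] by auto
    then have "Poly_Mapping.keys (bd4 s) = {}" by blast
    then show ?thesis using 0 by (simp add: eval_chain_def)
  next
    case (Suc n)
    then show ?thesis using dim4_le[of s] by (simp add: sum.delta)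
  qed
  finally show "dc \<omega> s = eval_chain (bd4 s) \<omega>" .
qed

lemma dc_dc [simp]: "dc (dc \<omega>) = 0"
  using boundary_square_zero_bd4 by (auto simp: dc_eq boundary_square_zero_def)

lemma dc_zero [simp]: "dc 0 = 0"
  by (auto simp: dc_eq zero_fun_def)

lemma dc_add: "dc (\<omega> + \<eta>) = dc \<omega> + dc \<eta>"
  by (auto simp: dc_eq plus_fun_def eval_chain_form_add)

lemma dc_scale: "dc (c *\<^sub>F \<omega>) = c *\<^sub>F dc \<omega>"
  by (auto simp: dc_eq form_scale_def eval_chain_form_scale)

text \<open>Holding for every \<open>r\<close> is useful: for \<open>r = 4\<close> the left side
  lies in degree 5 and vanishes, so \<open>dc\<close> kills forms of degree 4.\<close>

lemma form_part_dc_Suc: "form_part (Suc r) (dc \<omega>) = dc (form_part r \<omega>)"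
proof
  fix s
  show "form_part (Suc r) (dc \<omega>) s = dc (form_part r \<omega>) s"
  proof (cases "dim4 s = Suc r")
    case True
    then show ?thesis using boundary_degree_bd4
      by (auto simp: form_part_def dc_eq dest: boundary_degreeD intro!: eval_chain_cong)
  next
    case False
    then have "eval_chain (bd4 s) (form_part r \<omega>) = eval_chain (bd4 s) (\<lambda>_. 0)"
      using boundary_degree_bd4
      by (intro eval_chain_cong) (auto simp: form_part_def dest: boundary_degreeD)
    with False show ?thesis by (simp add: form_part_def dc_eq)
  qed
qed

lemma form_part_dc_0: "form_part 0 (dc \<omega>) = 0"
proof
  fix s
  have "eval_chain (bd4 s) \<omega> = eval_chain (bd4 s) (\<lambda>_. 0)" if "dim4 s = 0"
    using that boundary_degree_bd4
    by (intro eval_chain_cong) (auto dest: boundary_degreeD)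
  then show "form_part 0 (dc \<omega>) s = 0 s" by (simp add: form_part_def dc_eq)
qed


section \<open>The star operator\<close>

fun star_cell1 :: "cell \<Rightarrow> cell" where
  "star_cell1 (X k) = E k"
| "star_cell1 (E k) = X (k + 1)"

fun unstar_cell1 :: "cell \<Rightarrow> cell" where
  "unstar_cell1 (X k) = E (k - 1)"
| "unstar_cell1 (E k) = X k"

abbreviation star_cell :: "cell4 \<Rightarrow> cell4" where
  "star_cell \<equiv> map_prod (map_prod (map_prod star_cell1 star_cell1) star_cell1) star_cell1"

abbreviation unstar_cell :: "cell4 \<Rightarrow> cell4" where
  "unstar_cell \<equiv>
    map_prod (map_prod (map_prod unstar_cell1 unstar_cell1) unstar_cell1) unstar_cell1"

lemma unstar_star_cell1 [simp]: "unstar_cell1 (star_cell1 s) = s"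
  by (cases s) auto

lemma star_unstar_cell1 [simp]: "star_cell1 (unstar_cell1 s) = s"
  by (cases s) auto

lemma unstar_star_cell [simp]: "unstar_cell (star_cell s) = s"
  by (auto simp: map_prod_def split: prod.splits)

lemma star_unstar_cell [simp]: "star_cell (unstar_cell s) = s"
  by (auto simp: map_prod_def split: prod.splits)

lemma dim1_star_cell1: "dim1 s + dim1 (star_cell1 s) = 1"
  by (cases s) auto

lemma dim4_star_cell: "dim4 s + dim4 (star_cell s) = 4"
proof -
  obtain a b c d where s: "s = (((a, b), c), d)" by (metis prod.exhaust)
  show ?thesis
    using dim1_star_cell1[of a] dim1_star_cell1[of b] dim1_star_cell1[of c] dim1_star_cell1[of d]
    by (simp add: s dim4_def dim3_def dim2_def dim_tensor_def)
qed

section \<open>Duality of cells under the cup product\<close>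

lemma vol_map_prod: "vol = map_prod (map_prod (map_prod vol1 vol1) vol1) vol1"
  by (rule ext) (auto simp: map_prod_def split: prod.splits)

text \<open>An invariant that passes to tensor products and determines the star operator up to
  signs. The signs stay unspecified, since later only their squares matter.\<close>

definition cup_dual :: "('a \<Rightarrow> 'a \<Rightarrow> 'a form) \<Rightarrow> ('a \<Rightarrow> 'a) \<Rightarrow> ('a \<Rightarrow> 'a) \<Rightarrow> bool" where
  "cup_dual pr st vl \<longleftrightarrow> (\<forall>s t. pr s t (vl s) \<noteq> 0 \<longrightarrow> t = st s) \<and>
    (\<forall>s. pr s (st s) = basis_form (vl s) \<or> pr s (st s) = - basis_form (vl s))"

lemma cup_dual_cup1: "cup_dual cup1 star_cell1 vol1"
  unfolding cup_dual_def
proof (intro conjI allI impI)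
  fix s t assume "cup1 s t (vol1 s) \<noteq> 0"
  then show "t = star_cell1 s"
    by (cases s; cases t) (auto simp: basis_form_def split: if_splits)
next
  fix s show "cup1 s (star_cell1 s) = basis_form (vol1 s) \<or>
    cup1 s (star_cell1 s) = - basis_form (vol1 s)"
    by (cases s) auto
qed

lemma form_tensor_basis: "form_tensor (basis_form a) (basis_form b) = basis_form (a, b)"
  by (auto simp: form_tensor_def basis_form_def)

lemma form_tensor_minus:
  "form_tensor (- \<phi>) \<psi> = - form_tensor \<phi> \<psi>" "form_tensor \<phi> (- \<psi>) = - form_tensor \<phi> \<psi>"
  by (auto simp: form_tensor_def)

text \<open>A nonzero coefficient at the volume cell is a product of nonzero coefficients in the
  factors, each of which fixes its factor of \<open>t\<close>; all signs involved are units.\<close>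

lemma cup_dual_tensor:
  fixes pr :: "'a \<Rightarrow> 'a \<Rightarrow> 'a form"
  assumes "cup_dual pr st vl"
  shows "cup_dual (cup_tensor deg pr) (map_prod st star_cell1) (map_prod vl vol1)"
  unfolding cup_dual_def
proof (intro conjI allI impI)
  fix s t assume "cup_tensor deg pr s t (map_prod vl vol1 s) \<noteq> 0"
  then show "t = map_prod st star_cell1 s"
    using assms cup_dual_cup1
    by (cases s; cases t)
      (auto simp: cup_dual_def cup_tensor_def form_tensor_def form_scale_def split: if_splits)
next
  fix s :: "'a \<times> cell"
  obtain a x where s: "s = (a, x)" by (cases s)
  have 1: "pr a (st a) = basis_form (vl a) \<or> pr a (st a) = - basis_form (vl a)"
    using assms by (auto simp: cup_dual_def)
  have 2: "cup1 x (star_cell1 x) = basis_form (vol1 x) \<or>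
      cup1 x (star_cell1 x) = - basis_form (vol1 x)"
    using cup_dual_cup1 by (auto simp: cup_dual_def)
  have scale: "1 *\<^sub>F \<phi> = \<phi>" "(-1) *\<^sub>F \<phi> = - \<phi>" for \<phi> :: "('a \<times> cell) form"
    by (auto simp: form_scale_def)
  show "cup_tensor deg pr s (map_prod st star_cell1 s) = basis_form (map_prod vl vol1 s) \<or>
    cup_tensor deg pr s (map_prod st star_cell1 s) = - basis_form (map_prod vl vol1 s)"
    using 1 2 by (auto simp: s cup_tensor_def form_tensor_minus form_tensor_basis scale)
qed

lemma cup_dual_cup4: "cup_dual cup4 star_cell vol"
  unfolding cup4_def cup3_def cup2_def vol_map_prod
  by (intro cup_dual_tensor cup_dual_cup1)

section \<open>Explicit star operator and its inverse\<close>

lemma Sum_any_delta_point: "Sum_any (\<lambda>x. if x = a then f x else 0) = (f a :: real)"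
proof -
  have "Sum_any (\<lambda>x. if x = a then f x else 0) = (\<Sum>x\<in>{a}. if x = a then f x else 0)"
    by (rule Sum_any.expand_superset) auto
  then show ?thesis by simp
qed

lemma cup_basis: "basis_form s \<smile> basis_form t = cup4 s t"
proof
  fix u
  have "(basis_form s \<smile> basis_form t) u =
      Sum_any (\<lambda>p. if p = (s, t) then cup4 s t u else 0)"
    unfolding cup_def
  proof (rule Sum_any.cong)
    fix p :: "cell4 \<times> cell4"
    show "(case p of (a, b) \<Rightarrow> basis_form s a * (basis_form t) b * cup4 a b u) =
        (if p = (s, t) then cup4 s t u else 0)"
      by (cases p) (simp add: basis_form_def del: split_paired_All)
  qed
  then show "(basis_form s \<smile> basis_form t) u = cup4 s t u"
    by (simp add: Sum_any_delta_point)
qed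

lemma cup_minus_basis: "basis_form s \<smile> (- basis_form t) = - cup4 s t"
proof
  fix u
  have "(basis_form s \<smile> (- basis_form t)) u =
      Sum_any (\<lambda>p. if p = (s, t) then - cup4 s t u else 0)"
    unfolding cup_def
  proof (rule Sum_any.cong)
    fix p :: "cell4 \<times> cell4"
    show "(case p of (a, b) \<Rightarrow> basis_form s a * (- basis_form t) b * cup4 a b u) =
        (if p = (s, t) then - cup4 s t u else 0)"
      by (cases p) (simp add: basis_form_def del: split_paired_All)
  qed
  then show "(basis_form s \<smile> (- basis_form t)) u = (- cup4 s t) u"
    by (simp add: Sum_any_delta_point)
qed

text \<open>The sign solving the defining equation of the star; the cup coefficient is 1 or -1, so
  multiplying by it is dividing by it.\<close>

definition star_sign :: "cell4 \<Rightarrow> real" where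
  "star_sign s = lorentz_sign s * cup4 s (star_cell s) (vol s)"

lemma lorentz_sign_cases: "lorentz_sign s = 1 \<or> lorentz_sign s = -1"
  by (cases s rule: lorentz_sign.cases) (auto split: cell.splits)

lemma cup4_star_cell:
  "cup4 s (star_cell s) = basis_form (vol s) \<or> cup4 s (star_cell s) = - basis_form (vol s)"
  using cup_dual_cup4 unfolding cup_dual_def by blast

lemma star_sign_sq [simp]: "star_sign s * star_sign s = 1"
  using lorentz_sign_cases[of s] cup4_star_cell[of s]
  by (auto simp: star_sign_def basis_form_def)

lemma star_basis_eq: "star_basis s = star_sign s *\<^sub>F basis_form (star_cell s)"
  unfolding star_basis_def
proof (rule the_equality)
  have scale: "1 *\<^sub>F \<phi> = \<phi>" "(-1) *\<^sub>F \<phi> = - \<phi>" for \<phi> :: "cell4 form"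
    by (auto simp: form_scale_def)
  have "star_sign s = 1 \<or> star_sign s = -1"
    using star_sign_sq[of s] unfolding square_eq_1_iff .
  moreover have "cup4 s (star_cell s) =
      (lorentz_sign s * star_sign s) *\<^sub>F basis_form (vol s)"
    using cup4_star_cell[of s] lorentz_sign_cases[of s]
    by (auto simp: star_sign_def basis_form_def form_scale_def)
  ultimately show "(\<exists>t. star_sign s *\<^sub>F basis_form (star_cell s) = basis_form t \<or>
      star_sign s *\<^sub>F basis_form (star_cell s) = - basis_form t) \<and>
    basis_form s \<smile> (star_sign s *\<^sub>F basis_form (star_cell s)) =
      lorentz_sign s *\<^sub>F basis_form (vol s)"
    by (elim disjE; simp add: scale cup_basis cup_minus_basis del: split_paired_Ex)
      (blast, auto simp: form_scale_def fun_eq_iff simp del: split_paired_Ex)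
next
  fix \<phi>
  assume \<phi>: "(\<exists>t. \<phi> = basis_form t \<or> \<phi> = - basis_form t) \<and>
     basis_form s \<smile> \<phi> = lorentz_sign s *\<^sub>F basis_form (vol s)"
  then obtain t c where c: "c = 1 \<or> c = -1" and \<phi>_eq: "\<phi> = c *\<^sub>F basis_form t"
    unfolding form_scale_def by (metis (no_types) fun_Compl_def mult_1 mult_minus1)
  have "basis_form s \<smile> \<phi> = c *\<^sub>F cup4 s t"
    using c cup_basis[of s t] cup_minus_basis[of s t]
    by (auto simp: \<phi>_eq form_scale_def fun_Compl_def)
  \<comment> \<open>Reading the equation at \<open>vol s\<close> shows that the cup coefficient is
    nonzero, which by duality identifies \<open>t\<close>, and then fixes the sign
    \<open>c\<close>.\<close>
  then have val: "c * cup4 s t (vol s) = lorentz_sign s"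
    using \<phi> by (metis (no_types) basis_form_def form_scale_def mult.right_neutral)
  then have "cup4 s t (vol s) \<noteq> 0"
    using lorentz_sign_cases[of s] by auto
  then have t: "t = star_cell s"
    using cup_dual_cup4 unfolding cup_dual_def by blast
  have "star_sign s = c"
    using val c cup4_star_cell[of s] lorentz_sign_cases[of s]
    by (auto simp: star_sign_def t basis_form_def)
  then show "\<phi> = star_sign s *\<^sub>F basis_form (star_cell s)"
    by (simp add: \<phi>_eq t)
qed

lemma star_eq: "star \<omega> = (\<lambda>u. star_sign (unstar_cell u) * \<omega> (unstar_cell u))"
proof
  fix u
  have "star \<omega> u =
      Sum_any (\<lambda>s. if s = unstar_cell u then star_sign s * \<omega> s else 0)"
    unfolding star_def
    by (rule Sum_any.cong) (auto simp: star_basis_eq form_scale_def basis_form_def)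
  then show "star \<omega> u = star_sign (unstar_cell u) * \<omega> (unstar_cell u)"
    by (simp only: Sum_any_delta_point)
qed

lemma inv_star_eq: "inv star = (\<lambda>\<omega> s. star_sign s * \<omega> (star_cell s))"
proof (rule inv_equality)
  fix \<omega> show "(\<lambda>s. star_sign s * star \<omega> (star_cell s)) = \<omega>"
    by (rule ext) (simp add: star_eq mult.assoc[symmetric])
next
  fix \<omega> show "star (\<lambda>s. star_sign s * \<omega> (star_cell s)) = \<omega>"
    by (rule ext) (simp add: star_eq mult.assoc[symmetric])
qed


section \<open>The codifferential\<close>

text \<open>Absorbs the factor \<open>(-1) ^ r\<close> of \<open>codiff_deg\<close> into one linear
  operator, so that \<open>\<delta>c\<close> becomes a single composition on inhomogeneous
  forms.\<close>

definition parity_form :: "cell4 form \<Rightarrow> cell4 form" where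
  "parity_form \<omega> = (\<lambda>s. (-1) ^ dim4 s * \<omega> s)"

lemma star_add: "star (\<omega> + \<eta>) = star \<omega> + star \<eta>"
  by (auto simp: star_eq distrib_left)

lemma star_scale: "star (c *\<^sub>F \<omega>) = c *\<^sub>F star \<omega>"
  by (auto simp: star_eq form_scale_def)

lemma inv_star_add: "inv star (\<omega> + \<eta>) = inv star \<omega> + inv star \<eta>"
  by (auto simp: inv_star_eq distrib_left)

lemma inv_star_scale: "inv star (c *\<^sub>F \<omega>) = c *\<^sub>F inv star \<omega>"
  by (auto simp: inv_star_eq form_scale_def)

lemma inv_star_zero [simp]: "inv star 0 = 0"
  by (auto simp: inv_star_eq)

lemma star_zero [simp]: "star 0 = 0"
  by (auto simp: star_eq)

lemma form_part_star: "r \<le> 4 \<Longrightarrow> form_part (4 - r) (star \<omega>) = star (form_part r \<omega>)"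
proof
  fix s assume r: "r \<le> 4"
  have "dim4 (unstar_cell s) + dim4 s = 4"
    using dim4_star_cell[of "unstar_cell s"] by simp
  with r have "dim4 s = 4 - r \<longleftrightarrow> dim4 (unstar_cell s) = r" by linarith
  then show "form_part (4 - r) (star \<omega>) s = star (form_part r \<omega>) s"
    by (simp add: form_part_def star_eq)
qed

lemma form_part_inv_star:
  assumes "r \<le> 4"
  shows "form_part r (inv star \<omega>) = inv star (form_part (4 - r) \<omega>)"
proof
  fix s
  have "dim4 s = r \<longleftrightarrow> dim4 (star_cell s) = 4 - r"
    using assms dim4_star_cell[of s] by linarith
  then show "form_part r (inv star \<omega>) s = inv star (form_part (4 - r) \<omega>) s"
    by (simp add: form_part_def inv_star_eq)
qed

lemma form_part_eq_0: "4 < r \<Longrightarrow> form_part r \<omega> = 0"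
proof
  fix s assume "4 < r"
  then show "form_part r \<omega> s = 0 s"
    using dim4_le[of s] by (simp add: form_part_def)
qed

lemma sum_form_part: "(\<Sum>r\<le>4. form_part r \<omega>) = \<omega>"
  by (rule ext) (auto simp: sum_form_apply form_part_def dim4_le)

lemma codiff_deg_form_part:
  assumes "r \<le> 4"
  shows "codiff_deg r (form_part r \<omega>) = inv star (dc (star (parity_form (form_part r \<omega>))))"
proof -
  have parity: "parity_form (form_part r \<omega>) = (-1) ^ r *\<^sub>F form_part r \<omega>"
    by (auto simp: parity_form_def form_part_def form_scale_def)
  \<comment> \<open>\<open>codiff_deg 0\<close> is zero by definition; the composition agrees,
    because the star of a 0-form has degree 4 and its coboundary would have degree 5.\<close>
  have "dc (star (form_part 0 \<omega>)) = 0"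
    using form_part_dc_Suc[of 4 "star \<omega>"] form_part_star[of 0 \<omega>] by (simp add: form_part_eq_0)
  with assms show ?thesis
    by (auto simp: codiff_deg_def parity star_scale dc_scale inv_star_scale)
      (simp add: form_scale_def zero_fun_def)
qed

lemma parity_form_add: "parity_form (\<omega> + \<eta>) = parity_form \<omega> + parity_form \<eta>"
  by (auto simp: parity_form_def distrib_left)

lemma parity_form_zero [simp]: "parity_form 0 = 0"
  by (auto simp: parity_form_def)

text \<open>The composition is additive, so agreement on homogeneous components suffices.\<close>

lemma codiff_eq: "\<delta>c \<omega> = inv star (dc (star (parity_form \<omega>)))"
proof -
  let ?h = "\<lambda>\<omega>. inv star (dc (star (parity_form \<omega>)))"
  have "?h (\<omega> + \<eta>) = ?h \<omega> + ?h \<eta>" for \<omega> \<eta>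
    by (simp add: parity_form_add star_add dc_add inv_star_add)
  then have "?h (\<Sum>r\<in>I. f r) = (\<Sum>r\<in>I. ?h (f r))" for I :: "nat set" and f
    using sum_comp_morphism[of ?h f I] by (simp add: comp_def)
  then have "inv star (dc (star (parity_form (\<Sum>r\<le>4. form_part r \<omega>)))) = \<delta>c \<omega>"
    by (simp add: codiff_def codiff_deg_form_part)
  then show ?thesis by (simp add: sum_form_part)
qed

section \<open>Linearity, square and grading of the codifferential\<close>

lemma codiff_add: "\<delta>c (\<omega> + \<eta>) = \<delta>c \<omega> + \<delta>c \<eta>"
  by (simp add: codiff_eq parity_form_add star_add dc_add inv_star_add)

lemma codiff_scale: "\<delta>c (c *\<^sub>F \<omega>) = c *\<^sub>F \<delta>c \<omega>"
proof -
  have "parity_form (c *\<^sub>F \<omega>) = c *\<^sub>F parity_form \<omega>"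
    by (auto simp: parity_form_def form_scale_def)
  then show ?thesis by (simp add: codiff_eq star_scale dc_scale inv_star_scale)
qed

lemma codiff_zero [simp]: "\<delta>c 0 = 0"
  by (simp add: codiff_eq)

lemma form_part_parity: "form_part r (parity_form \<omega>) = parity_form (form_part r \<omega>)"
  by (auto simp: form_part_def parity_form_def)

lemma parity_form_dc: "parity_form (dc \<omega>) = - dc (parity_form \<omega>)"
proof
  fix s
  have "eval_chain (bd4 s) (parity_form \<omega>) = eval_chain (bd4 s) (\<lambda>t. - ((-1) ^ dim4 s) * \<omega> t)"
    using boundary_degree_bd4
    by (intro eval_chain_cong) (auto simp: parity_form_def dest: boundary_degreeD)
  also have "\<dots> = - ((-1) ^ dim4 s) * eval_chain (bd4 s) \<omega>"
    by (rule eval_chain_form_scale)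
  finally show "parity_form (dc \<omega>) s = (- dc (parity_form \<omega>)) s"
    by (simp add: dc_eq parity_form_def)
qed

text \<open>Degrees \<open>r\<close> and \<open>4 - r\<close> have the same parity, and the star
  signs square to 1.\<close>

lemma star_parity_inv_star: "star (parity_form (inv star \<omega>)) = parity_form \<omega>"
proof
  fix s
  have "dim4 (unstar_cell s) + dim4 s = 4"
    using dim4_star_cell[of "unstar_cell s"] by simp
  then have "even (dim4 (unstar_cell s)) = even (dim4 s)"
    by (metis even_add even_numeral)
  then have "(-1) ^ dim4 (unstar_cell s) = ((-1) ^ dim4 s :: real)"
    by (simp add: minus_one_power_iff)
  moreover have "star_sign u * (x * (star_sign u * y)) = x * y" for u x y
    by (simp add: mult.assoc[symmetric] mult.commute[of "star_sign u" x])
  ultimately show "star (parity_form (inv star \<omega>)) s = parity_form \<omega> s"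
    by (simp add: star_eq parity_form_def inv_star_eq)
qed

lemma codiff_form_part_0: "\<delta>c (form_part 0 \<omega>) = 0"
proof -
  have "form_part 5 (dc (star (parity_form \<omega>))) = dc (star (form_part 0 (parity_form \<omega>)))"
    using form_part_dc_Suc[of 4 "star (parity_form \<omega>)"] form_part_star[of 0 "parity_form \<omega>"]
    by simp
  then show ?thesis by (simp add: codiff_eq form_part_eq_0 flip: form_part_parity)
qed

text \<open>The inner \<open>inv star\<close> and \<open>star\<close> cancel around the parity
  operator, which anticommutes with \<open>dc\<close>; what remains contains \<open>dc\<close> twice
  in a row.\<close>

lemma codiff_codiff [simp]: "\<delta>c (\<delta>c \<omega>) = 0"
proof -
  have "dc (- \<phi>) = - dc \<phi>" for \<phi>
    using dc_add[of \<phi> "- \<phi>"] by (simp add: eq_neg_iff_add_eq_0 add.commute)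
  then show ?thesis by (simp add: codiff_eq star_parity_inv_star parity_form_dc)
qed

lemma form_part_codiff: "form_part r (\<delta>c \<omega>) = \<delta>c (form_part (Suc r) \<omega>)"
proof -
  consider "r < 4" | "r = 4" | "4 < r" by linarith
  then show ?thesis
  proof cases
    case 1
    \<comment> \<open>The star sends degree \<open>r + 1\<close> to \<open>4 - (r + 1)\<close>, and
      \<open>dc\<close> raises this to \<open>4 - r\<close>; truncated subtraction makes
      \<open>r = 4\<close> a separate case.\<close>
    then have "Suc (4 - Suc r) = 4 - r" by simp
    with 1 show ?thesis
      using form_part_dc_Suc[of "4 - Suc r" "star (parity_form \<omega>)"]
        form_part_star[of "Suc r" "parity_form \<omega>"]
      by (simp add: codiff_eq form_part_inv_star form_part_parity)
  next
    case 2
    then show ?thesis by (simp add: codiff_eq form_part_inv_star form_part_dc_0 form_part_eq_0)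
  next
    case 3
    then show ?thesis by (simp add: form_part_eq_0)
  qed
qed


section \<open>The Duffin decomposition\<close>

lemma form_scale_add: "c *\<^sub>F (\<omega> + \<eta>) = c *\<^sub>F \<omega> + c *\<^sub>F \<eta>"
  by (auto simp: form_scale_def distrib_left)

lemma form_scale_zero [simp]: "c *\<^sub>F 0 = 0"
  by (auto simp: form_scale_def)

lemma form_scale_minus: "c *\<^sub>F (- \<omega>) = - (c *\<^sub>F \<omega>)"
  by (auto simp: form_scale_def)

lemma form_scale_diff: "c *\<^sub>F (\<omega> - \<eta>) = c *\<^sub>F \<omega> - c *\<^sub>F \<eta>"
  by (auto simp: form_scale_def right_diff_distrib)

lemma form_scale_scale: "c *\<^sub>F d *\<^sub>F \<omega> = (c * d) *\<^sub>F \<omega>"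
  by (auto simp: form_scale_def)

lemma form_scale_one [simp]: "1 *\<^sub>F \<omega> = \<omega>"
  by (auto simp: form_scale_def)

lemma dc_diff: "dc (\<omega> - \<eta>) = dc \<omega> - dc \<eta>"
  using dc_add[of "\<omega> - \<eta>" \<eta>] by simp

lemma codiff_diff: "\<delta>c (\<omega> - \<eta>) = \<delta>c \<omega> - \<delta>c \<eta>"
  using codiff_add[of "\<omega> - \<eta>" \<eta>] by simp

lemma dc_sum: "dc (\<Sum>i\<in>I. f i) = (\<Sum>i\<in>I. dc (f i))"
  using sum_comp_morphism[of dc f I] by (simp add: dc_add comp_def)

lemma codiff_sum: "\<delta>c (\<Sum>i\<in>I. f i) = (\<Sum>i\<in>I. \<delta>c (f i))"
  using sum_comp_morphism[of codiff f I] by (simp add: codiff_add comp_def)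

lemma form_part_add: "form_part r (\<omega> + \<eta>) = form_part r \<omega> + form_part r \<eta>"
  by (auto simp: form_part_def)

lemma form_part_diff: "form_part r (\<omega> - \<eta>) = form_part r \<omega> - form_part r \<eta>"
  by (auto simp: form_part_def)

lemma form_part_scale: "form_part r (c *\<^sub>F \<omega>) = c *\<^sub>F form_part r \<omega>"
  by (auto simp: form_part_def form_scale_def)

lemma form_part_in_K: "form_part r \<omega> \<in> K r"
  by (auto simp: form_part_def K_def)

lemma form_part_K: "\<omega> \<in> K q \<Longrightarrow> form_part r \<omega> = (if r = q then \<omega> else 0)"
  by (rule ext, unfold K_def form_part_def) force

lemma form_part_sum_K:
  assumes "\<And>r. r \<le> 4 \<Longrightarrow> \<omega> r \<in> K r" "q \<le> 4"
  shows "form_part q (\<Sum>r\<le>4. \<omega> r) = \<omega> q"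
proof
  fix s
  have "\<omega> r s = 0" if "r \<le> 4" "dim4 s \<noteq> r" for r
    using assms(1)[OF that(1)] that(2) unfolding K_def by blast
  then have "(\<Sum>r\<le>4. \<omega> r s) = (\<Sum>r\<le>4. if r = dim4 s then \<omega> r s else 0)"
    by (intro sum.cong) auto
  also have "\<dots> = \<omega> (dim4 s) s"
    using dim4_le[of s] by simp
  finally show "form_part q (\<Sum>r\<le>4. \<omega> r) s = \<omega> q s"
    using \<open>\<And>r. r \<le> 4 \<Longrightarrow> dim4 s \<noteq> r \<Longrightarrow> \<omega> r s = 0\<close>[of q] assms(2)
    by (simp add: form_part_def sum_form_apply)
qed

text \<open>In degree 0 there is no incoming coboundary. For \<open>r = 3\<close> the codifferential
  term has degree 5 and drops out.\<close>

lemma DK_equation_parts: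
  assumes "DK_equation m \<Omega>"
  shows "- \<delta>c (form_part 1 \<Omega>) = m *\<^sub>F form_part 0 \<Omega>"
    and "dc (form_part r \<Omega>) - \<delta>c (form_part (Suc (Suc r)) \<Omega>) = m *\<^sub>F form_part (Suc r) \<Omega>"
proof -
  have "form_part q (dc \<Omega>) - form_part q (\<delta>c \<Omega>) = m *\<^sub>F form_part q \<Omega>" for q
    using assms by (simp add: DK_equation_def form_part_scale flip: form_part_diff)
  from this[of 0] this[of "Suc r"]
  show "- \<delta>c (form_part 1 \<Omega>) = m *\<^sub>F form_part 0 \<Omega>"
    and "dc (form_part r \<Omega>) - \<delta>c (form_part (Suc (Suc r)) \<Omega>) = m *\<^sub>F form_part (Suc r) \<Omega>"
    by (simp_all add: form_part_dc_0 form_part_dc_Suc form_part_codiff)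
qed

lemma Duffin_equation_DK: "Duffin_equation m r \<Psi> \<Longrightarrow> DK_equation m \<Psi>"
  by (simp add: Duffin_equation_def DK_equation_def)

lemma form_part_K_pair:
  assumes "\<Psi> \<in> K_pair r" "q \<noteq> r" "q \<noteq> Suc r"
  shows "form_part q \<Psi> = 0"
proof -
  obtain \<alpha> \<beta> where "\<Psi> = \<alpha> + \<beta>" "\<alpha> \<in> K r" "\<beta> \<in> K (Suc r)"
    using assms(1) by (auto simp: K_pair_def)
  with assms(2,3) show ?thesis
    by (simp add: form_part_add form_part_K)
qed

lemma sum_form_part_K_pair:
  assumes "\<Psi> \<in> K_pair r"
  shows "\<Psi> = form_part r \<Psi> + form_part (Suc r) \<Psi>"
proof -
  obtain \<alpha> \<beta> where "\<Psi> = \<alpha> + \<beta>" "\<alpha> \<in> K r" "\<beta> \<in> K (Suc r)"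
    using assms by (auto simp: K_pair_def)
  then show ?thesis
    by (simp add: form_part_add form_part_K)
qed

lemma Duffin_equation_parts:
  assumes "Duffin_equation m r \<Psi>"
  shows "dc (form_part r \<Psi>) = m *\<^sub>F form_part (Suc r) \<Psi>"
    and "- \<delta>c (form_part (Suc r) \<Psi>) = m *\<^sub>F form_part r \<Psi>"
    and "\<delta>c (form_part r \<Psi>) = 0"
proof -
  have K: "\<Psi> \<in> K_pair r" and DK: "DK_equation m \<Psi>"
    using assms by (auto simp: Duffin_equation_DK Duffin_equation_def)
  note zero = form_part_K_pair[OF K]
  show 1: "dc (form_part r \<Psi>) = m *\<^sub>F form_part (Suc r) \<Psi>"
    using DK_equation_parts(2)[OF DK, of r] by (simp add: zero)
  show 2: "- \<delta>c (form_part (Suc r) \<Psi>) = m *\<^sub>F form_part r \<Psi>"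
  proof (cases r)
    case 0
    then show ?thesis using DK_equation_parts(1)[OF DK] by simp
  next
    case (Suc n)
    then show ?thesis using DK_equation_parts(2)[OF DK, of n] by (simp add: zero)
  qed
  show "\<delta>c (form_part r \<Psi>) = 0"
  proof (cases r)
    case 0
    then show ?thesis
      by (simp add: codiff_form_part_0)
  next
    case (Suc n)
    have "\<delta>c (form_part r \<Psi>) = form_part n (\<delta>c \<Psi>)"
      by (simp add: Suc form_part_codiff)
    also have "\<dots> = form_part n (dc \<Psi>) - m *\<^sub>F form_part n \<Psi>"
      using DK by (simp add: DK_equation_def form_part_diff flip: form_part_scale)
        (metis diff_diff_eq2 add_diff_cancel_left' form_part_diff)
    \<comment> \<open>\<open>K_pair r\<close> starts in degree \<open>r = Suc n\<close>, so
      \<open>\<Psi>\<close> has no components in degree \<open>n\<close> or below.\<close>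
    also have "form_part n \<Psi> = 0" by (simp add: zero Suc)
    also have "form_part n (dc \<Psi>) = 0"
      by (cases n) (simp_all add: form_part_dc_0 form_part_dc_Suc zero Suc)
    finally show ?thesis by (simp only: form_scale_zero diff_zero)
  qed
qed

text \<open>Replaces the case distinctions at \<open>r = 0\<close> and \<open>r = 3\<close> by one
  formula in \<Omega>, on which both existence and uniqueness rest. For \<open>r = 0\<close> the
  equation in degree 0 expresses \<open>\<omega> 0\<close> through \<open>\<delta>c\<close>.\<close>

lemma Duffin_form_eq:
  assumes "m \<noteq> 0" "DK_equation m \<Omega>" "r \<le> 3" "\<And>q. q \<le> 4 \<Longrightarrow> \<omega> q = form_part q \<Omega>"
  shows "Duffin_form m \<omega> r =
    (1 / m) *\<^sub>F (dc (form_part r \<Omega>) - \<delta>c (form_part (Suc r) \<Omega>))"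
proof -
  have inv: "(1 / m) *\<^sub>F m *\<^sub>F \<phi> = \<phi>" for \<phi> :: "cell4 form"
    using assms(1) by (simp add: form_scale_scale)
  have low: "(if r = 0 then \<omega> 0 else part2 m \<omega> r) = - ((1 / m) *\<^sub>F \<delta>c (form_part (Suc r) \<Omega>))"
    using assms(3,4) arg_cong[OF DK_equation_parts(1)[OF assms(2)], of "\<lambda>\<phi>. (1 / m) *\<^sub>F \<phi>"]
    by (simp add: part2_def inv form_scale_minus)
  have "form_part (Suc r) \<Omega> + (1 / m) *\<^sub>F \<delta>c (form_part (Suc (Suc r)) \<Omega>) =
      (1 / m) *\<^sub>F dc (form_part r \<Omega>)"
    using arg_cong[OF DK_equation_parts(2)[OF assms(2), of r], of "\<lambda>\<phi>. (1 / m) *\<^sub>F \<phi>"]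
    by (simp add: inv form_scale_diff algebra_simps)
  \<comment> \<open>For \<open>r = 3\<close> this removes the codifferential term, leaving
    \<open>\<omega> 4\<close> unsplit.\<close>
  moreover have "form_part 5 \<Omega> = 0" by (simp add: form_part_eq_0)
  ultimately have "(if r = 3 then \<omega> 4 else part1 m \<omega> (r + 1)) = (1 / m) *\<^sub>F dc (form_part r \<Omega>)"
    using assms(3,4) by (auto simp: part1_def eval_nat_numeral)
  with low show ?thesis by (simp add: Duffin_form_def form_scale_diff)
qed

text \<open>Since \<open>dc\<close> and \<open>\<delta>c\<close> square to zero, only the mixed
  terms \<open>- dc (\<delta>c ?b)\<close> and \<open>- \<delta>c (dc ?a)\<close> remain; the
  equation in degrees \<open>r\<close> and \<open>r + 1\<close> evaluates them.\<close>

lemma Duffin_equation_part: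
  assumes "m \<noteq> 0" "DK_equation m \<Omega>"
  shows "Duffin_equation m r ((1 / m) *\<^sub>F (dc (form_part r \<Omega>) - \<delta>c (form_part (Suc r) \<Omega>)))"
proof -
  let ?a = "form_part r \<Omega>" and ?b = "form_part (Suc r) \<Omega>"
  \<comment> \<open>Applying \<open>dc\<close> to the equation in degree \<open>r\<close> kills the
    incoming coboundary, which is absent for \<open>r = 0\<close>.\<close>
  have ddelta: "dc (\<delta>c ?b) = - (m *\<^sub>F dc ?a)"
  proof (cases r)
    case 0
    then show ?thesis
      using arg_cong[OF DK_equation_parts(1)[OF assms(2)], of dc] dc_diff[of 0 "\<delta>c ?b"]
      by (simp add: dc_scale minus_equation_iff)
  next
    case (Suc n)
    then show ?thesis
      using arg_cong[OF DK_equation_parts(2)[OF assms(2), of n], of dc]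
      by (simp add: dc_diff dc_scale) (metis minus_minus)
  qed
  have deltad: "\<delta>c (dc ?a) = m *\<^sub>F \<delta>c ?b"
    using arg_cong[OF DK_equation_parts(2)[OF assms(2), of r], of codiff]
    by (simp add: codiff_diff codiff_scale)
  have "dc ?a = form_part (Suc r) (dc \<Omega>)" "\<delta>c ?b = form_part r (\<delta>c \<Omega>)"
    by (simp_all add: form_part_dc_Suc form_part_codiff)
  then have "(1 / m) *\<^sub>F (dc ?a - \<delta>c ?b) =
      form_part r (- ((1 / m) *\<^sub>F \<delta>c \<Omega>)) + form_part (r + 1) ((1 / m) *\<^sub>F dc \<Omega>)"
    by (auto simp: form_part_def form_scale_def)
  then have "(1 / m) *\<^sub>F (dc ?a - \<delta>c ?b) \<in> K_pair r"
    unfolding K_pair_def using form_part_in_K by blast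
  moreover have "dc ((1 / m) *\<^sub>F (dc ?a - \<delta>c ?b)) - \<delta>c ((1 / m) *\<^sub>F (dc ?a - \<delta>c ?b)) =
      m *\<^sub>F (1 / m) *\<^sub>F (dc ?a - \<delta>c ?b)"
    using assms(1)
    by (simp add: dc_scale codiff_scale dc_diff codiff_diff ddelta deltad form_scale_scale
        form_scale_diff form_scale_minus)
  ultimately show ?thesis by (simp add: Duffin_equation_def)
qed

text \<open>The right side depends only on the sum, so the sum determines every summand; it is the
  same expression as in \<open>Duffin_form_eq\<close>.\<close>

lemma Duffin_decomposition_unique:
  assumes m: "m \<noteq> 0" and \<Psi>: "\<And>r. r \<le> 3 \<Longrightarrow> Duffin_equation m r (\<Psi> r)" and r: "r \<le> 3"
  shows "\<Psi> r = (1 / m) *\<^sub>F (dc (form_part r (\<Sum>r\<le>3. \<Psi> r))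
    - \<delta>c (form_part (Suc r) (\<Sum>r\<le>3. \<Psi> r)))"
proof -
  have inv: "(1 / m) *\<^sub>F m *\<^sub>F \<phi> = \<phi>" for \<phi> :: "cell4 form"
    using m by (simp add: form_scale_scale)
  have zero: "form_part q (\<Psi> p) = 0" if "p \<le> 3" "q \<noteq> p" "q \<noteq> Suc p" for p q
    using form_part_K_pair[OF _ that(2,3)] \<Psi>[OF that(1)] by (simp add: Duffin_equation_def)
  have part: "form_part q (\<Sum>r\<le>3. \<Psi> r) = (\<Sum>r\<le>3. form_part q (\<Psi> r))" for q
    by (rule ext) (simp add: form_part_def sum_form_apply)
  \<comment> \<open>The upper component times \<open>m\<close> is the coboundary of the lower one,
    hence closed.\<close>
  have dc_top: "dc (form_part (Suc p) (\<Psi> p)) = 0" if "p \<le> 3" for p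
  proof -
    have "dc (m *\<^sub>F form_part (Suc p) (\<Psi> p)) = 0"
      by (simp flip: Duffin_equation_parts(1)[OF \<Psi>[OF that]])
    then have "(1 / m) *\<^sub>F m *\<^sub>F dc (form_part (Suc p) (\<Psi> p)) = 0"
      by (simp add: dc_scale)
    then show ?thesis by (simp only: inv)
  qed
  \<comment> \<open>In degree \<open>r\<close> only \<open>\<Psi> r\<close> and the upper component
    of its predecessor occur, and \<open>dc\<close> kills the latter.\<close>
  have "dc (form_part r (\<Sum>r\<le>3. \<Psi> r)) =
      (\<Sum>p\<le>3. if p = r then dc (form_part r (\<Psi> r)) else 0)"
    unfolding part dc_sum
  proof (rule sum.cong)
    fix p :: nat assume "p \<in> {..3}"
    then show "dc (form_part r (\<Psi> p)) = (if p = r then dc (form_part r (\<Psi> r)) else 0)"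
      using zero[of p r] dc_top[of p] by (cases "r = Suc p") auto
  qed simp
  then have dc: "dc (form_part r (\<Sum>r\<le>3. \<Psi> r)) = m *\<^sub>F form_part (Suc r) (\<Psi> r)"
    using r by (simp add: Duffin_equation_parts(1)[OF \<Psi>[OF r]])
  \<comment> \<open>Dually, in degree \<open>r + 1\<close> the lower component of the successor is
    killed by \<open>\<delta>c\<close>.\<close>
  have "\<delta>c (form_part (Suc r) (\<Sum>r\<le>3. \<Psi> r)) =
      (\<Sum>p\<le>3. if p = r then \<delta>c (form_part (Suc r) (\<Psi> r)) else 0)"
    unfolding part codiff_sum
  proof (rule sum.cong)
    fix p :: nat assume "p \<in> {..3}"
    then show "\<delta>c (form_part (Suc r) (\<Psi> p)) =
        (if p = r then \<delta>c (form_part (Suc r) (\<Psi> r)) else 0)"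
      using zero[of p "Suc r"] Duffin_equation_parts(3)[OF \<Psi>, of p] by (cases "p = Suc r") auto
  qed simp
  then have codiff: "- \<delta>c (form_part (Suc r) (\<Sum>r\<le>3. \<Psi> r)) = m *\<^sub>F form_part r (\<Psi> r)"
    using r by (simp add: Duffin_equation_parts(2)[OF \<Psi>[OF r]])
  have "\<Psi> r = form_part (Suc r) (\<Psi> r) + form_part r (\<Psi> r)"
    using sum_form_part_K_pair[of "\<Psi> r" r] \<Psi>[OF r] by (simp add: Duffin_equation_def add.commute)
  also have "\<dots> = (1 / m) *\<^sub>F (m *\<^sub>F form_part (Suc r) (\<Psi> r) + m *\<^sub>F form_part r (\<Psi> r))"
    by (simp add: form_scale_add inv)
  finally show ?thesis by (simp flip: dc codiff)
qed

theorem theorem5p2: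
  fixes m :: real and \<omega> :: "nat \<Rightarrow> cell4 form" and \<Omega> :: "cell4 form"
  assumes "m \<noteq> 0"
    and "\<And>r. r \<le> 4 \<Longrightarrow> \<omega> r \<in> K r"
    and "\<Omega> = (\<Sum>r\<le>4. \<omega> r)"
    and "DK_equation m \<Omega>"
  shows "(\<forall>r\<in>{1, 2, 3}. \<omega> r = part1 m \<omega> r + part2 m \<omega> r) \<and>
    (\<forall>r\<le>3. Duffin_equation m r (Duffin_form m \<omega> r)) \<and>
    \<Omega> = (\<Sum>r\<le>3. Duffin_form m \<omega> r) \<and>
    (\<forall>\<Psi>. (\<forall>r\<le>3. Duffin_equation m r (\<Psi> r)) \<and> \<Omega> = (\<Sum>r\<le>3. \<Psi> r) \<longrightarrow>
      (\<forall>r\<le>3. \<Psi> r = Duffin_form m \<omega> r))"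
proof (intro conjI allI impI ballI)
  have part: "\<omega> q = form_part q \<Omega>" if "q \<le> 4" for q
    using form_part_sum_K[of \<omega> q] assms(2,3) that by simp
  note form_eq = Duffin_form_eq[OF assms(1,4) _ part]
  show "\<omega> r = part1 m \<omega> r + part2 m \<omega> r" for r
    by (simp add: part1_def part2_def)
  show "Duffin_equation m r (Duffin_form m \<omega> r)" if "r \<le> 3" for r
    using Duffin_equation_part[OF assms(1,4)] form_eq[OF that] by simp
  \<comment> \<open>Regrouping by degree, the added and subtracted codifferential terms cancel in
    degrees 1, 2 and 3.\<close>
  have "{..4} = {0, 1, 2, 3, 4::nat}" "{..3} = {0, 1, 2, 3::nat}" by auto
  then show "\<Omega> = (\<Sum>r\<le>3. Duffin_form m \<omega> r)"
    by (simp add: assms(3) Duffin_form_def part1_def part2_def eval_nat_numeral)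
  show "\<Psi> r = Duffin_form m \<omega> r"
    if "(\<forall>r\<le>3. Duffin_equation m r (\<Psi> r)) \<and> \<Omega> = (\<Sum>r\<le>3. \<Psi> r)" "r \<le> 3" for \<Psi> r
    using Duffin_decomposition_unique[of m \<Psi> r] that assms(1) form_eq[of r] by auto
qed

end
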